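(* Let $(p_n)_{n\geqslant 0}$ and $(q_n)_{n\geqslant 0}$ be real sequences with $p_0>0$, $q_0>0$ and $p_n\geqslant 0$, $q_n\geqslant 0$ for all $n>0$, and suppose that the Nörlund methods $(N,p)$ and $(N,q)$ are finite, i.e. $\sum_{n\geqslant 0}p_n<\infty$ and $\sum_{n\geqslant 0}q_n<\infty$. Let $(k_n)_{n\geqslant 0}$ be the unique real sequence satisfying $q_n = k_0p_n+k_1p_{n-1}+\cdots+k_np_0$ for all $n\geqslant 0$, and let $[q:p]=\sum_{n\geqslant 0}|k_n|\in[0,\infty]$. Then $(N,q)$ includes $(N,p)$ if and only if $[q:p]<\infty$.
   Context: Let $(p_n)_{n\geqslant 0}$ be a real sequence with $p_0>0$ and $p_n\geqslant 0$ for $n>0$, and let $P_m=p_0+\cdots+p_m$. The Nörlund method $(N,p)$ associates to each sequence $s=(s_n)_{n\geqslant 0}$ of complex numbers the sequence $(t_m)_{m\geqslant 0}$ given by $$t_m=\frac{1}{P_m}\sum_{n=0}^m p_{m-n}s_n .$$ The sequence $s$ is $(N,p)$-convergent to $\sigma$ if $t_m\to\sigma$ in the ordinary sense as $m\to\infty$. A series is $(N,p)$-summable with sum $\sigma$ if its sequence of partial sums is $(N,p)$-convergent to $\sigma$. The same definitions apply to $(N,q)$. The method $(N,p)$ is called finite if $\sum_{n\geqslant 0}p_n$ converges. The method $(N,q)$ includes $(N,p)$ (written $(N,p)\rightsquigarrow(N,q)$) if every series that is $(N,p)$-summable is $(N,q)$-summable to the same sum; equivalently, every sequence that is $(N,p)$-convergent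 to some $\sigma$ is $(N,q)$-convergent to the same $\sigma$. The sequence $(k_n)$ is determined recursively by its defining convolution system since $p_0\neq 0$. *)

theory Defs
  imports "HOL-Analysis.Analysis"
begin

definition norlund_mean :: "(nat \<Rightarrow> real) \<Rightarrow> (nat \<Rightarrow> complex) \<Rightarrow> nat \<Rightarrow> complex" where
  "norlund_mean p s m =
     (\<Sum>n\<le>m. complex_of_real (p (m - n)) * s n) / complex_of_real (\<Sum>n\<le>m. p n)"

definition norlund_converges :: "(nat \<Rightarrow> real) \<Rightarrow> (nat \<Rightarrow> complex) \<Rightarrow> complex \<Rightarrow> bool" where
  "norlund_converges p s \<sigma> \<longleftrightarrow> norlund_mean p s \<longlonglongrightarrow> \<sigma>"

definition norlund_sums :: "(nat \<Rightarrow> real) \<Rightarrow> (nat \<Rightarrow> complex) \<Rightarrow> complex \<Rightarrow> bool" where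
  "norlund_sums p a \<sigma> \<longleftrightarrow> norlund_converges p (\<lambda>n. \<Sum>i\<le>n. a i) \<sigma>"

definition norlund_finite :: "(nat \<Rightarrow> real) \<Rightarrow> bool" where
  "norlund_finite p \<longleftrightarrow> summable p"

(* Argument order: (N,q) includes (N,p), over series with terms a. *)
definition norlund_includes :: "(nat \<Rightarrow> real) \<Rightarrow> (nat \<Rightarrow> real) \<Rightarrow> bool" where
  "norlund_includes q p \<longleftrightarrow> (\<forall>a \<sigma>. norlund_sums p a \<sigma> \<longrightarrow> norlund_sums q a \<sigma>)"

definition norlund_quotient :: "(nat \<Rightarrow> real) \<Rightarrow> (nat \<Rightarrow> real) \<Rightarrow> (nat \<Rightarrow> real) \<Rightarrow> bool" where
  "norlund_quotient q p k \<longleftrightarrow> (\<forall>n. q n = (\<Sum>i\<le>n. k i * p (n - i)))"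

lemma norlund_quotient_ex1:
  fixes p q :: "nat \<Rightarrow> real"
  assumes "p 0 \<noteq> 0"
  shows "\<exists>!k. norlund_quotient q p k"
proof -
  have iff: "norlund_quotient q p k \<longleftrightarrow> Abs_fps k * Abs_fps p = Abs_fps q" for k
    unfolding norlund_quotient_def fps_eq_iff fps_mult_nth fps_nth_Abs_fps atLeast0AtMost
    by (rule all_cong1) (rule eq_commute)
  have "fps_nth (Abs_fps p) 0 \<noteq> 0" using assms by simp
  hence inv: "inverse (Abs_fps p) * Abs_fps p = 1" by (rule inverse_mult_eq_1)
  have eta: "Abs_fps (fps_nth f) = f" for f :: "real fps"
    by (rule fps_ext) simp
  show ?thesis
  proof (rule ex1I)
    let ?k = "fps_nth (Abs_fps q * inverse (Abs_fps p))"
    show "norlund_quotient q p ?k"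
      unfolding iff eta mult.assoc inv by simp
  next
    fix k assume "norlund_quotient q p k"
    hence *: "Abs_fps q = Abs_fps k * Abs_fps p" by (simp only: iff)
    have "Abs_fps q * inverse (Abs_fps p) = Abs_fps k * (inverse (Abs_fps p) * Abs_fps p)"
      unfolding * mult.assoc by (subst mult.commute[of "Abs_fps p"]) (rule refl)
    hence "Abs_fps q * inverse (Abs_fps p) = Abs_fps k" unfolding inv by simp
    thus "k = fps_nth (Abs_fps q * inverse (Abs_fps p))" by (simp add: fun_eq_iff)
  qed
qed

(* [q:p] in terms of the quotient sequence k, i.e. norlund_quotient q p k. *)
definition norlund_bracket :: "(nat \<Rightarrow> real) \<Rightarrow> ennreal" where
  "norlund_bracket k = (\<Sum>n. ennreal \<bar>k n\<bar>)"

end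

(* Write u = p * s for the unnormalised means. As p_0 is nonzero, s \<mapsto> u is a bijection of
   sequences, and since p and q are summable with positive sums, inclusion says precisely that
   convolution with k maps every sequence u \<longlonglongrightarrow> L to a sequence converging to L (\<Sum>q) / (\<Sum>p).
   If k is absolutely summable, this is Tannery's theorem together with the Cauchy product
   \<Sum>q = (\<Sum>k) (\<Sum>p). Otherwise a gliding hump yields a null sequence u for which k * u is
   unbounded. *)
theory Submission
  imports Defs
begin

text \<open>Extended by zero beyond \<open>i = m\<close>, the \<open>m\<close>-th sum is a series
  whose \<open>i\<close>-th term tends to \<open>k i * L\<close> and is dominated by
  \<open>norm (k i) * B\<close>, where \<open>B\<close> bounds \<open>u\<close>; Tannery's theorem
  then exchanges limit and sum.\<close>

lemma tendsto_convolution: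
  fixes k u :: "nat \<Rightarrow> 'a :: {real_normed_field, banach}"
  assumes k: "summable (\<lambda>n. norm (k n))" and u: "u \<longlonglongrightarrow> L"
  shows "(\<lambda>m. \<Sum>i\<le>m. k i * u (m - i)) \<longlonglongrightarrow> (\<Sum>n. k n) * L"
proof -
  obtain B where B: "\<And>n. norm (u n) \<le> B"
    using convergent_imp_Bseq[of u] u by (auto simp: convergent_def Bseq_def)
  define a where "a i m = (if i \<le> m then k i * u (m - i) else 0)" for i m
  have "(\<lambda>m. a i m) \<longlonglongrightarrow> k i * L" for i
  proof (rule LIMSEQ_offset[where k = i])
    show "(\<lambda>m. a i (m + i)) \<longlonglongrightarrow> k i * L"
      by (simp add: a_def) (intro tendsto_intros u)
  qed
  moreover have "norm (a i m) \<le> norm (k i) * B" for i m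
    using order_trans[OF norm_ge_zero B]
    by (auto simp: a_def norm_mult intro!: mult_left_mono B)
  hence "eventually (\<lambda>(i, m). norm (a i m) \<le> norm (k i) * B) (at_top \<times>\<^sub>F sequentially)"
    by (intro always_eventually) auto
  moreover have "summable (\<lambda>i. norm (k i) * B)"
    using k by (rule summable_mult2)
  ultimately have "(\<lambda>m. \<Sum>i. a i m) \<longlonglongrightarrow> (\<Sum>i. k i * L)"
    by (intro tannerys_theorem[THEN conjunct2, THEN conjunct2]) auto
  moreover have "(\<Sum>i. a i m) = (\<Sum>i\<le>m. k i * u (m - i))" for m
    by (subst suminf_finite[of "{..m}"]) (auto simp: a_def)
  moreover have "(\<Sum>i. k i * L) = (\<Sum>n. k n) * L"
    using suminf_mult2[OF summable_norm_cancel[OF k]] by simp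
  ultimately show ?thesis by simp
qed

text \<open>The hump of \<open>u\<close> on \<open>{m i<..m (Suc i)}\<close> has height \<open>1 / (i + 1)\<close> and signs matching
  \<open>k\<close> in row \<open>m (Suc i)\<close> of the convolution; \<open>m (Suc i)\<close> is chosen so large that this
  hump outweighs all earlier ones by \<open>i + 1\<close>.\<close>
lemma unbounded_convolution_null_sequence:
  fixes k :: "nat \<Rightarrow> real"
  assumes "Bseq k" and nonsum: "\<not> summable (\<lambda>n. \<bar>k n\<bar>)"
  obtains u where "u \<longlonglongrightarrow> 0" and "\<not> Bseq (\<lambda>m. \<Sum>i\<le>m. k i * u (m - i))"
proof -
  obtain B where B: "\<And>n. \<bar>k n\<bar> \<le> B" using assms(1) by (auto simp: Bseq_def)
  have B0: "B \<ge> 0" using B[of 0] by linarith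
  \<comment> \<open>The condition \<open>d > 0\<close> will make the block ends \<open>m i\<close>
    strictly increasing, even if \<open>C\<close> is negative.\<close>
  have large: "\<exists>d>0. C \<le> (\<Sum>j<d. \<bar>k j\<bar>)" for C
  proof (rule ccontr)
    assume "\<not> ?thesis"
    hence *: "(\<Sum>j<d. \<bar>k j\<bar>) < C" if "d > 0" for d using that by (meson not_le)
    have "(\<Sum>j<d. \<bar>k j\<bar>) \<le> \<bar>C\<bar>" for d
    proof (cases "d = 0")
      case False
      thus ?thesis using *[of d] by linarith
    qed simp
    hence "summable (\<lambda>n. \<bar>k n\<bar>)"
      by (rule summableI_nonneg_bounded[rotated]) (rule abs_ge_zero)
    with nonsum show False by contradiction
  qed
  \<comment> \<open>The factor \<open>i + 1\<close> outside pays for the hump height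
    \<open>1 / (i + 1)\<close>. Inside, \<open>(m i + 1) * B\<close> covers the terms at the
    positions \<open>0, ..., m i\<close> of \<open>u\<close>, and \<open>i + 1\<close> is the
    surplus.\<close>
  have "\<exists>m :: nat \<Rightarrow> nat. \<forall>i. True \<and> (m i < m (Suc i) \<and>
      real (i + 1) * (real (m i + 1) * B + real (i + 1)) \<le> (\<Sum>j<m (Suc i) - m i. \<bar>k j\<bar>))"
  proof (rule dependent_nat_choice)
    fix x i :: nat
    obtain d where "d > 0" "real (i + 1) * (real (x + 1) * B + real (i + 1)) \<le> (\<Sum>j<d. \<bar>k j\<bar>)"
      using large by blast
    thus "\<exists>y. True \<and> (x < y \<and>
      real (i + 1) * (real (x + 1) * B + real (i + 1)) \<le> (\<Sum>j<y - x. \<bar>k j\<bar>))"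
      by (intro exI[of _ "x + d"]) auto
  qed auto
  then obtain m :: "nat \<Rightarrow> nat" where m_less: "\<And>i. m i < m (Suc i)"
    and m_large: "\<And>i. real (i + 1) * (real (m i + 1) * B + real (i + 1))
                       \<le> (\<Sum>j<m (Suc i) - m i. \<bar>k j\<bar>)"
    by blast
  have mono: "strict_mono m" using m_less by (auto intro: strict_mono_Suc_iff[THEN iffD2])
  \<comment> \<open>\<open>I n\<close> is the number of the block that contains \<open>n\<close>;
    the positions up to \<open>m 0\<close> are counted in block 0. In row \<open>m (Suc i)\<close>
    the entry \<open>u n\<close> meets \<open>k (m (Suc i) - n)\<close>, hence the sign chosen for
    \<open>u n\<close>.\<close>
  define I where "I n = (LEAST i. n \<le> m (Suc i))" for n
  define u where "u n = sgn (k (m (Suc (I n)) - n)) / real (I n + 1)" for n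
  have n_le: "n \<le> m (Suc (I n))" for n
  proof -
    have "n \<le> m (Suc n)"
      using strict_mono_imp_increasing[OF mono, of "Suc n"] by linarith
    thus ?thesis unfolding I_def by (rule LeastI)
  qed
  have I_eq: "I n = i" if "m i < n" "n \<le> m (Suc i)" for n i
    unfolding I_def
  proof (rule Least_equality)
    fix j assume "n \<le> m (Suc j)"
    with that(1) have "m i < m (Suc j)" by linarith
    thus "i \<le> j" using mono by (simp add: strict_mono_less)
  qed (fact that)
  have I_ge: "i \<le> I n" if "m i < n" for i n
  proof -
    have "m i < m (Suc (I n))" using that n_le[of n] by linarith
    thus ?thesis using mono by (simp add: strict_mono_less)
  qed
  have u_bound: "\<bar>u n\<bar> \<le> 1 / real (I n + 1)" for n
    by (auto simp: u_def abs_mult abs_sgn_eq)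
  have u_le1: "\<bar>u n\<bar> \<le> 1" for n
    by (rule order_trans[OF u_bound]) simp
  have "u \<longlonglongrightarrow> 0"
  proof (rule LIMSEQ_I)
    fix e :: real assume "e > 0"
    then obtain i where i: "inverse (real (Suc i)) < e" using reals_Archimedean by blast
    have "norm (u n - 0) < e" if "n \<ge> Suc (m i)" for n
    proof -
      have "\<bar>u n\<bar> \<le> 1 / real (I n + 1)" by (rule u_bound)
      also have "\<dots> \<le> 1 / real (i + 1)"
        using I_ge[of i n] that by (intro divide_left_mono) auto
      also have "\<dots> < e" using i by (simp add: inverse_eq_divide add.commute)
      finally show ?thesis by simp
    qed
    thus "\<exists>N. \<forall>n\<ge>N. norm (u n - 0) < e" by blast
  qed
  moreover have "\<not> Bseq (\<lambda>m. \<Sum>i\<le>m. k i * u (m - i))"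
  proof
    assume "Bseq (\<lambda>m. \<Sum>i\<le>m. k i * u (m - i))"
    then obtain C where C: "\<And>m. \<bar>\<Sum>i\<le>m. k i * u (m - i)\<bar> \<le> C" by (auto simp: Bseq_def)
    obtain i :: nat where i: "C < real i" using reals_Archimedean2 by blast
    define d where "d = m (Suc i) - m i"
    \<comment> \<open>For \<open>j < d\<close> the position \<open>m (Suc i) - j\<close> exceeds
      \<open>m i\<close>, so it lies in hump \<open>i\<close>; the indices \<open>j \<ge> d\<close>
      are the \<open>m i + 1\<close> pairings with earlier positions.\<close>
    have split: "{..m (Suc i)} = {..<d} \<union> {d..m (Suc i)}" and d_le: "d \<le> m (Suc i)"
      using m_less[of i] by (auto simp: d_def)
    have "(\<Sum>j<d. k j * u (m (Suc i) - j)) = (\<Sum>j<d. \<bar>k j\<bar>) / real (i + 1)"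
      unfolding sum_divide_distrib
    proof (rule sum.cong)
      fix j assume j: "j \<in> {..<d}"
      hence "I (m (Suc i) - j) = i" by (intro I_eq) (auto simp: d_def)
      moreover have "m (Suc i) - (m (Suc i) - j) = j" using j d_le by simp
      ultimately show "k j * u (m (Suc i) - j) = \<bar>k j\<bar> / real (i + 1)"
        by (simp add: u_def abs_sgn)
    qed simp
    also have "\<dots> \<ge> real (m i + 1) * B + real (i + 1)"
      using m_large[of i] by (subst pos_le_divide_eq) (auto simp: d_def mult.commute)
    finally have hump: "real (m i + 1) * B + real (i + 1) \<le> (\<Sum>j<d. k j * u (m (Suc i) - j))" .
    have "\<bar>\<Sum>j=d..m (Suc i). k j * u (m (Suc i) - j)\<bar> \<le> (\<Sum>j=d..m (Suc i). B * 1)"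
      by (rule order_trans[OF sum_abs], unfold abs_mult, intro sum_mono mult_mono B u_le1 B0 abs_ge_zero)
    also have "\<dots> = real (m i + 1) * B"
      using m_less[of i] by (simp add: d_def Suc_diff_le)
    finally have "\<bar>\<Sum>j=d..m (Suc i). k j * u (m (Suc i) - j)\<bar> \<le> real (m i + 1) * B" .
    moreover have "(\<Sum>j\<le>m (Suc i). k j * u (m (Suc i) - j)) =
        (\<Sum>j<d. k j * u (m (Suc i) - j)) + (\<Sum>j=d..m (Suc i). k j * u (m (Suc i) - j))"
      unfolding split by (rule sum.union_disjoint) auto
    ultimately show False using hump C[of "m (Suc i)"] i by linarith
  qed
  ultimately show ?thesis by (rule that)
qed

text \<open>Any sequence is the sequence of partial sums of its differences, so quantifying over
  series loses nothing.\<close>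

lemma norlund_includes_iff:
  "norlund_includes q p \<longleftrightarrow> (\<forall>s \<sigma>. norlund_converges p s \<sigma> \<longrightarrow> norlund_converges q s \<sigma>)"
proof
  assume incl: "norlund_includes q p"
  show "\<forall>s \<sigma>. norlund_converges p s \<sigma> \<longrightarrow> norlund_converges q s \<sigma>"
  proof (intro allI impI)
    fix s \<sigma> assume "norlund_converges p s \<sigma>"
    moreover define a where "a n = (if n = 0 then s 0 else s n - s (n - 1))" for n
    have "(\<lambda>n. \<Sum>i\<le>n. a i) = s"
    proof
      show "(\<Sum>i\<le>n. a i) = s n" for n by (induction n) (auto simp: a_def)
    qed
    ultimately show "norlund_converges q s \<sigma>"
      using incl unfolding norlund_includes_def norlund_sums_def by metis
  qed
qed (simp add: norlund_includes_def norlund_sums_def)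

text \<open>The generating function turns convolution into a product, so that associativity and
  inversion are available from the ring of power series.\<close>

definition complex_fps :: "(nat \<Rightarrow> real) \<Rightarrow> complex fps" where
  "complex_fps p = Abs_fps (\<lambda>n. complex_of_real (p n))"

text \<open>The normalising sums are nonzero and tend to \<open>suminf p > 0\<close>, so multiplying
  or dividing by them preserves convergence.\<close>

lemma norlund_converges_iff:
  assumes "\<And>n. p n \<ge> 0" "p 0 > 0" "summable p"
  shows "norlund_converges p s \<sigma> \<longleftrightarrow>
    fps_nth (complex_fps p * Abs_fps s) \<longlonglongrightarrow> \<sigma> * complex_of_real (suminf p)"
proof -
  define P where "P m = complex_of_real (\<Sum>n\<le>m. p n)" for m
  define N where "N = fps_nth (complex_fps p * Abs_fps s)"
  have P0: "P m \<noteq> 0" for m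
  proof -
    have "p 0 \<le> (\<Sum>n\<le>m. p n)" using assms(1) by (intro member_le_sum) auto
    thus ?thesis using assms(2) by (simp add: P_def del: of_real_sum)
  qed
  have lim: "P \<longlonglongrightarrow> complex_of_real (suminf p)"
    unfolding P_def using summable_LIMSEQ'[OF assms(3)] by (intro tendsto_of_real)
  have pos: "suminf p > 0" using assms by (intro suminf_pos2[where i = 0]) auto
  have mean: "norlund_mean p s m = N m / P m" for m
    unfolding norlund_mean_def N_def P_def complex_fps_def
    by (subst mult.commute) (simp add: fps_mult_nth atLeast0AtMost mult.commute)
  show ?thesis
    unfolding norlund_converges_def N_def[symmetric]
  proof
    assume "norlund_mean p s \<longlonglongrightarrow> \<sigma>"
    from tendsto_mult[OF this lim] show "N \<longlonglongrightarrow> \<sigma> * complex_of_real (suminf p)"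
      using P0 by (simp add: mean)
  next
    assume "N \<longlonglongrightarrow> \<sigma> * complex_of_real (suminf p)"
    from tendsto_divide[OF this lim] show "norlund_mean p s \<longlonglongrightarrow> \<sigma>"
      using pos by (simp add: mean[abs_def])
  qed
qed

theorem theorem2:
  fixes p q k :: "nat \<Rightarrow> real"
  assumes "p 0 > 0" and "\<And>n. n > 0 \<Longrightarrow> p n \<ge> 0"
    and "q 0 > 0" and "\<And>n. n > 0 \<Longrightarrow> q n \<ge> 0"
    and "norlund_finite p" and "norlund_finite q"
    and "norlund_quotient q p k"
  shows "norlund_includes q p \<longleftrightarrow> norlund_bracket k < \<infinity>"
proof -
  have p: "p n \<ge> 0" "summable p" and q: "q n \<ge> 0" "summable q" for n
    using assms(1-6) by (cases "n = 0"; simp add: norlund_finite_def)+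
  note p_iff = norlund_converges_iff[OF p(1) assms(1) p(2)]
  note q_iff = norlund_converges_iff[OF q(1) assms(3) q(2)]
  have q_eq: "q n = (\<Sum>i\<le>n. k i * p (n - i))" for n
    using assms(7) by (simp add: norlund_quotient_def)
  have Q: "complex_fps q = complex_fps k * complex_fps p"
    by (rule fps_ext) (simp add: complex_fps_def fps_mult_nth q_eq atLeast0AtMost)
  have bracket: "norlund_bracket k < \<infinity> \<longleftrightarrow> summable (\<lambda>n. \<bar>k n\<bar>)"
    unfolding norlund_bracket_def infinity_ennreal_def less_top[symmetric]
    by (rule iffI, erule summable_suminf_not_top[rotated], simp, erule ennreal_suminf_neq_top, simp)
  show ?thesis
    unfolding bracket
  proof
    assume k: "summable (\<lambda>n. \<bar>k n\<bar>)"
    have "suminf q = suminf k * suminf p"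
      unfolding q_eq[abs_def] using k p by (intro Cauchy_product[symmetric]) auto
    moreover have "(\<Sum>n. complex_of_real (k n)) = complex_of_real (suminf k)"
      using k by (rule suminf_of_real[symmetric, OF summable_rabs_cancel])
    \<comment> \<open>The limit supplied by \<open>tendsto_convolution\<close> is the one that
      \<open>q_iff\<close> demands.\<close>
    ultimately have sums: "(\<Sum>n. complex_of_real (k n)) * (\<sigma> * complex_of_real (suminf p)) =
        \<sigma> * complex_of_real (suminf q)" for \<sigma>
      by simp
    show "norlund_includes q p"
      unfolding norlund_includes_iff p_iff q_iff
    proof (intro allI impI)
      fix s \<sigma>
      define U where "U = complex_fps p * Abs_fps s"
      assume "fps_nth (complex_fps p * Abs_fps s) \<longlonglongrightarrow> \<sigma> * complex_of_real (suminf p)"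
      hence "fps_nth U \<longlonglongrightarrow> \<sigma> * complex_of_real (suminf p)" by (simp add: U_def)
      with k have "(\<lambda>m. \<Sum>i\<le>m. complex_of_real (k i) * fps_nth U (m - i)) \<longlonglongrightarrow>
          (\<Sum>n. complex_of_real (k n)) * (\<sigma> * complex_of_real (suminf p))"
        by (intro tendsto_convolution) auto
      hence "fps_nth (complex_fps k * U) \<longlonglongrightarrow> \<sigma> * complex_of_real (suminf q)"
        unfolding sums by (simp add: fps_mult_nth[abs_def] complex_fps_def atLeast0AtMost)
      thus "fps_nth (complex_fps q * Abs_fps s) \<longlonglongrightarrow> \<sigma> * complex_of_real (suminf q)"
        by (simp add: Q U_def mult.assoc)
    qed
  next
    assume incl: "norlund_includes q p"
    \<comment> \<open>Dividing \<open>u\<close> by \<open>p\<close> as power series gives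
      \<open>s\<close> with \<open>p * s = u\<close>. Then \<open>s\<close> is
      \<open>(N,p)\<close>-convergent to 0, and inclusion makes
      \<open>q * s = k * p * s = k * u\<close> null.\<close>
    have null: "(\<lambda>m. \<Sum>i\<le>m. k i * u (m - i)) \<longlonglongrightarrow> 0" if "u \<longlonglongrightarrow> 0" for u
    proof -
      define s where "s = fps_nth (inverse (complex_fps p) * complex_fps u)"
      have "fps_nth (complex_fps p) 0 \<noteq> 0" using assms(1) by (simp add: complex_fps_def)
      hence "complex_fps p * inverse (complex_fps p) = 1"
        by (rule inverse_mult_eq_1')
      hence ps: "complex_fps p * Abs_fps s = complex_fps u"
        by (simp add: s_def fps_nth_inverse mult.assoc[symmetric])
      have "fps_nth (complex_fps u) \<longlonglongrightarrow> 0"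
        using tendsto_of_real[OF that, where 'a = complex]
        by (simp add: complex_fps_def Abs_fps_inverse)
      hence "norlund_converges p s 0" by (simp add: p_iff ps)
      hence "norlund_converges q s 0" using incl by (simp add: norlund_includes_iff)
      hence "fps_nth (complex_fps k * complex_fps u) \<longlonglongrightarrow> 0"
        by (simp add: q_iff Q mult.assoc ps)
      hence "(\<lambda>m. complex_of_real (\<Sum>i\<le>m. k i * u (m - i))) \<longlonglongrightarrow> complex_of_real 0"
        by (simp add: complex_fps_def fps_mult_nth[abs_def] atLeast0AtMost)
      thus ?thesis by (simp only: tendsto_of_real_iff)
    qed
    \<comment> \<open>The convolution unit is itself a null sequence, so \<open>null\<close> applied
      to it shows that \<open>k\<close> is null; this gives the boundedness of \<open>k\<close>
      required by the gliding hump.\<close>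
    define e :: "nat \<Rightarrow> real" where "e n = (if n = 0 then 1 else 0)" for n
    have "e \<longlonglongrightarrow> 0"
      by (rule LIMSEQ_offset[where k = 1]) (simp add: e_def)
    moreover have "(\<Sum>i\<le>m. k i * e (m - i)) = k m" for m
    proof -
      have "(\<Sum>i\<le>m. k i * e (m - i)) = (\<Sum>i\<in>{m}. k i * e (m - i))"
        by (rule sum.mono_neutral_right) (auto simp: e_def)
      thus ?thesis by (simp add: e_def)
    qed
    ultimately have "k \<longlonglongrightarrow> 0" using null[of e] by simp
    hence "Bseq k" by (intro convergent_imp_Bseq convergentI)
    show "summable (\<lambda>n. \<bar>k n\<bar>)"
    proof (rule ccontr)
      assume "\<not> ?thesis"
      with \<open>Bseq k\<close> obtain u where "u \<longlonglongrightarrow> 0" "\<not> Bseq (\<lambda>m. \<Sum>i\<le>m. k i * u (m - i))"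
        by (rule unbounded_convolution_null_sequence)
      thus False using null convergent_imp_Bseq convergentI by blast
    qed
  qed
qed

end
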